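(* Let $G$ be a group that is planar and $2$-locally finite. Then $G$ is locally finite.
   Context: For a group $G$, the subgroup graph $\mathcal{L}(G)$ is the graph whose vertices are all subgroups of $G$, two subgroups $H,K$ being adjacent if one of them is a maximal subgroup of the other. $G$ is called planar if $\mathcal{L}(G)$ is a planar graph (embeddable in the plane). A group is $n$-locally finite if every subgroup generated by at most $n$ elements is finite; it is locally finite if it is $n$-locally finite for all $n\geq 1$. *)

theory Defs
  imports "HOL-Analysis.Analysis" "HOL-Algebra.Algebra"
begin

text \<open>A graph with vertex set V and edge set E (each edge given once as an ordered pair
  of distinct vertices) is planar if it admits an embedding in the plane (here the
  complex plane): vertices go injectively to points, each edge to an arc joining the
  images of its endpoints, an arc meets no vertex point other than its endpoints,
  and two distinct edges' arcs meet only in images of common endpoints.\<close>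

definition planar_graph :: "'v set \<Rightarrow> ('v \<times> 'v) set \<Rightarrow> bool" where
  "planar_graph V E \<longleftrightarrow>
     (\<exists>(f :: 'v \<Rightarrow> complex) (c :: 'v \<times> 'v \<Rightarrow> real \<Rightarrow> complex).
        inj_on f V \<and>
        (\<forall>(u, v) \<in> E. arc (c (u, v)) \<and> pathstart (c (u, v)) = f u \<and> pathfinish (c (u, v)) = f v
             \<and> path_image (c (u, v)) \<inter> f ` V \<subseteq> {f u, f v}) \<and>
        (\<forall>e1 \<in> E. \<forall>e2 \<in> E. e1 \<noteq> e2 \<longrightarrow>
             path_image (c e1) \<inter> path_image (c e2) \<subseteq> f ` ({fst e1, snd e1} \<inter> {fst e2, snd e2})))"

definition maximal_subgroup :: "('a, 'b) monoid_scheme \<Rightarrow> 'a set \<Rightarrow> 'a set \<Rightarrow> bool" where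
  "maximal_subgroup G H K \<longleftrightarrow>
     subgroup H G \<and> subgroup K G \<and> H \<subset> K \<and>
     (\<forall>L. subgroup L G \<longrightarrow> H \<subseteq> L \<longrightarrow> L \<subseteq> K \<longrightarrow> L = H \<or> L = K)"

text \<open>The subgroup graph: vertices all subgroups; H--K adjacent iff one is maximal in the other.
  Each edge is recorded once, oriented from the maximal subgroup to the larger group.\<close>
definition subgroup_graph_vertices :: "('a, 'b) monoid_scheme \<Rightarrow> 'a set set" where
  "subgroup_graph_vertices G = {H. subgroup H G}"

definition subgroup_graph_edges :: "('a, 'b) monoid_scheme \<Rightarrow> ('a set \<times> 'a set) set" where
  "subgroup_graph_edges G = {(H, K). maximal_subgroup G H K}"

definition planar_group :: "('a, 'b) monoid_scheme \<Rightarrow> bool" where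
  "planar_group G \<longleftrightarrow> planar_graph (subgroup_graph_vertices G) (subgroup_graph_edges G)"

definition n_locally_finite :: "nat \<Rightarrow> ('a, 'b) monoid_scheme \<Rightarrow> bool" where
  "n_locally_finite n G \<longleftrightarrow>
     (\<forall>S. S \<subseteq> carrier G \<longrightarrow> finite S \<longrightarrow> card S \<le> n \<longrightarrow> finite (generate G S))"

definition locally_finite_group :: "('a, 'b) monoid_scheme \<Rightarrow> bool" where
  "locally_finite_group G \<longleftrightarrow> (\<forall>n\<ge>1. n_locally_finite n G)"

end

theory Submission
  imports Defs
begin

text \<open>Suppose G is planar and every n-generated subgroup is finite (n at least 2), but that H = \<langle>h1, h2, R\<rangle>
  is n-generated with \<langle>H, g\<rangle> infinite. Put x1 = h1, x2 = h2, x3 = h1 h2 and let M i be the finite subgroup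
  \<langle>xi, R, g\<rangle>. Any two of the subgroups H \<inter> M i generate H, while none of the M i contains H, so the
  H \<inter> M i are pairwise incomparable. Each of them is joined upwards to H, downwards to
  the trivial subgroup, and through M i to \<langle>g\<rangle>; these paths yield a minor K33 of the subgroup graph.\<close>

text \<open>The elements h1, h2, h1 h2 serve because any two of them generate the third; trading the
  pair h1, h2 for one of them brings the n+1 generators down to n, so \<open>M i\<close> is finite.
  The obstacle is that G may be infinite and covers in its subgroup lattice need not exist. All
  paths are therefore taken inside the finite subgroups H and \<open>M i\<close>, where comparable
  subgroups are linked by chains of maximal subgroups. Incomparability of the H \<inter>
  \<open>M i\<close> keeps such paths apart: nothing lies strictly above one of them and strictly
  below another. Planarity means an actual embedding, possibly of an infinite graph, so the
  non-planarity of K33 is obtained from plane topology rather than by counting faces. Contraction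
  also happens in the plane: a connected set of vertices turns into a path-connected union of arcs,
  and K33 becomes a statement about three points and three such sets.\<close>

subsection \<open>Three points and three connected sets in the plane\<close>

text \<open>A path from a into B is stopped at its first parameter t in B, which exists because the
  preimage of B is compact. K - {u} is then the image of the half-open interval up to t, hence still
  connected; this is what later keeps it on one side of a Jordan curve.\<close>

lemma path_connected_first_hit:
  fixes S B :: "'a::t2_space set"
  assumes "path_connected S" "closed B" "a \<in> S" "a \<notin> B" "S \<inter> B \<noteq> {}"
  obtains K u where "compact K" "connected K" "K \<subseteq> S" "a \<in> K" "K \<inter> B = {u}" "connected (K - {u})"
proof -
  obtain z where z: "z \<in> S" "z \<in> B" using assms by blast
  obtain g where g: "path g" "path_image g \<subseteq> S" "pathstart g = a" "pathfinish g = z"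
    using assms(1,3) z(1) unfolding path_connected_def by metis
  have cont: "continuous_on {0..1} g" using g(1) by (simp add: path_def)
  let ?T = "{0..1} \<inter> g -` B"
  have "compact ?T"
    using continuous_closed_preimage[OF cont _ assms(2)] by (meson bounded_Int bounded_closed_interval closed_real_atLeastAtMost compact_eq_bounded_closed)
  moreover have "1 \<in> ?T" using g z by (auto simp: pathfinish_def)
  ultimately obtain t where t: "t \<in> ?T" and tmin: "\<And>s. s \<in> ?T \<Longrightarrow> t \<le> s"
    using compact_attains_inf[of ?T] by blast
  have lt: "g s \<notin> B" if "0 \<le> s" "s < t" for s
    using tmin[of s] t that by force
  let ?K = "g ` {0..t}"
  have t1: "{0..t} \<subseteq> {0..1}" "{0..<t} \<subseteq> {0..1}" using t by auto
  have cK: "continuous_on {0..t} g" "continuous_on {0..<t} g"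
    using cont t1 continuous_on_subset by blast+
  have KB: "?K \<inter> B = {g t}" using t lt by (force simp: less_le)
  have "{0..t} = insert t {0..<t}" using t by auto
  then have "?K - {g t} = g ` {0..<t}" using lt t by force
  then have "connected (?K - {g t})"
    using connected_continuous_image[OF cK(2)] by simp
  moreover have "a \<in> ?K" using g(3) t by (auto simp: pathstart_def)
  moreover have "?K \<subseteq> S" using g(2) t1 by (auto simp: path_image_def)
  moreover have "compact ?K" "connected ?K"
    using cK(1) by (auto intro: compact_continuous_image connected_continuous_image)
  ultimately show ?thesis using KB that by blast
qed

text \<open>By injectivity the two subarcs share only the cutting point. As u is not an end of the
  arc, each end belongs to exactly one half, so either half can serve as an obstacle that leaves one
  end free.\<close>

lemma arc_split_at:
  fixes \<beta> :: "real \<Rightarrow> 'a::t2_space"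
  assumes "arc \<beta>" "u \<in> path_image \<beta>" "u \<noteq> pathstart \<beta>" "u \<noteq> pathfinish \<beta>"
  obtains P Q where "compact P" "compact Q" "P \<union> Q = path_image \<beta>" "P \<inter> Q = {u}"
    "pathstart \<beta> \<in> P" "pathstart \<beta> \<notin> Q" "pathfinish \<beta> \<in> Q" "pathfinish \<beta> \<notin> P"
proof -
  obtain t where t: "t \<in> {0..1}" "\<beta> t = u" using assms(2) by (auto simp: path_image_def)
  have inj: "inj_on \<beta> {0..1}" and cont: "continuous_on {0..1} \<beta>"
    using assms(1) by (auto simp: arc_def path_def)
  have t01: "0 < t" "t < 1" using t assms(3,4) by (force simp: pathstart_def pathfinish_def less_le)+
  let ?P = "\<beta> ` {0..t}" and ?Q = "\<beta> ` {t..1}"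
  have sub: "{0..t} \<subseteq> {0..1}" "{t..1} \<subseteq> {0..1}" using t by auto
  have "compact ?P" "compact ?Q"
    using cont sub by (meson compact_Icc compact_continuous_image continuous_on_subset)+
  moreover have "{0..t} \<union> {t..1} = {0..1}" using t by auto
  then have "?P \<union> ?Q = path_image \<beta>" by (metis image_Un path_image_def)
  moreover have "?P \<inter> ?Q = \<beta> ` ({0..t} \<inter> {t..1})" using inj_on_image_Int[OF inj sub] by simp
  moreover have "{0..t} \<inter> {t..1} = {t}" using t by auto
  moreover have "\<beta> 0 \<in> ?P" "\<beta> 1 \<in> ?Q" using t01 by auto
  moreover have "\<beta> 0 \<notin> ?Q" using inj_onD[OF inj, of 0] t01 by fastforce
  moreover have "\<beta> 1 \<notin> ?P" using inj_onD[OF inj, of 1] t01 by fastforce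
  ultimately show ?thesis using that[of ?P ?Q] t(2) by (auto simp: pathstart_def pathfinish_def)
qed

text \<open>This produces a tripod with feet a, b, d and centre u: an arc from b to d, and a leg
  from a stopped where it first meets that arc. The centre lies in Y, so it differs from all feet.
  The leg need not be an arc; compactness and connectedness suffice.\<close>

lemma tripod_in_path_connected:
  fixes Y :: "'a::{complete_space,real_normed_vector} set"
  assumes "path_connected (insert a Y)" "path_connected (insert b Y)" "path_connected (insert d Y)"
    and "path_connected Y" "Y \<noteq> {}"
    and "a \<noteq> b" "a \<noteq> d" "b \<noteq> d" "a \<notin> Y" "b \<notin> Y" "d \<notin> Y"
  obtains \<beta> K u P Q where
    "arc \<beta>" "pathstart \<beta> = b" "pathfinish \<beta> = d" "path_image \<beta> \<subseteq> insert b (insert d Y)"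
    "compact K" "connected K" "K \<subseteq> insert a Y" "a \<in> K" "K \<inter> path_image \<beta> = {u}" "connected (K - {u})"
    "compact P" "compact Q" "P \<union> Q = path_image \<beta>" "P \<inter> Q = {u}" "b \<in> P" "b \<notin> Q" "d \<in> Q" "d \<notin> P"
proof -
  have "path_connected (insert b Y \<union> insert d Y)"
    using assms(2,3,5) by (intro path_connected_Un) auto
  moreover have "insert b Y \<union> insert d Y = insert b (insert d Y)" by auto
  ultimately have "path_connected (insert b (insert d Y))" by simp
  then obtain \<beta> where \<beta>: "arc \<beta>" "path_image \<beta> \<subseteq> insert b (insert d Y)" "pathstart \<beta> = b" "pathfinish \<beta> = d"
    using \<open>b \<noteq> d\<close> unfolding path_connected_arcwise by (metis insertI1 insertI2)
  \<comment> \<open>An arc from b to d that missed Y would have the two-point image {b, d}, which is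
    not connected.\<close>
  have ne: "insert a Y \<inter> path_image \<beta> \<noteq> {}"
  proof
    assume "insert a Y \<inter> path_image \<beta> = {}"
    then have im: "path_image \<beta> = {b, d}" using \<beta> by (auto intro: pathstart_in_path_image pathfinish_in_path_image)
    have "connected (path_image \<beta>)" using \<beta>(1) connected_arc_image by blast
    then show False using im \<open>b \<noteq> d\<close> connected_finite_iff_sing[of "{b,d}"] by auto
  qed
  have "a \<notin> path_image \<beta>" using assms \<beta>(2) by auto
  then obtain K u where K: "compact K" "connected K" "K \<subseteq> insert a Y" "a \<in> K" 
      "K \<inter> path_image \<beta> = {u}" "connected (K - {u})"
    using path_connected_first_hit[of "insert a Y" "path_image \<beta>" a] assms(1) ne
    by (metis \<beta>(1) arc_imp_path compact_imp_closed compact_path_image insertI1)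
  have "u \<in> path_image \<beta>" "u \<noteq> b" "u \<noteq> d" using K assms by auto
  then obtain P Q where "compact P" "compact Q" "P \<union> Q = path_image \<beta>" "P \<inter> Q = {u}" "b \<in> P" "b \<notin> Q" "d \<in> Q" "d \<notin> P"
    using arc_split_at[OF \<beta>(1), of u] \<beta> by metis
  then show ?thesis using that \<beta> K by metis
qed

text \<open>The sets Y 1 and Y 2 contain a theta graph: a closed curve J = P \<union> Q through b and d, with b
  only in P and d only in Q, and a cross-cut K through a. Being joined to a inside Y 3, a point q of
  Y 3 lies on the side of J containing the interior of K. A point q' on the other side can be joined
  to q avoiding K \<union> P (via d) and avoiding K \<union> Q (via b). As the two obstacles meet in the connected
  set K, Janiszewski's theorem joins q to q' off J, contradicting the Jordan curve theorem.\<close>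

lemma no_plane_K33:
  fixes a b d :: complex
  assumes conn: "\<And>i x. i \<in> {1,2,3} \<Longrightarrow> x \<in> {a,b,d} \<Longrightarrow> path_connected (insert x (Y i))"
    and pc: "\<And>i. i \<in> {1,2,3::nat} \<Longrightarrow> path_connected (Y i)"
    and ne: "\<And>i. i \<in> {1,2,3} \<Longrightarrow> Y i \<noteq> {}"
    and av: "\<And>i. i \<in> {1,2,3} \<Longrightarrow> Y i \<inter> {a,b,d} = {}"
    and dj: "\<And>i j. i \<in> {1,2,3} \<Longrightarrow> j \<in> {1,2,3} \<Longrightarrow> i \<noteq> j \<Longrightarrow> Y i \<inter> Y j = {}"
    and dist: "a \<noteq> b" "a \<noteq> d" "b \<noteq> d"
  shows False
proof -
  have d12: "Y 1 \<inter> Y 2 = {}" "Y 1 \<inter> Y 3 = {}" "Y 2 \<inter> Y 3 = {}"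
    using dj[of 1 2] dj[of 1 3] dj[of 2 3] by simp_all
  have avs: "a \<notin> Y i" "b \<notin> Y i" "d \<notin> Y i" if "i \<in> {1,2,3}" for i using av[OF that] by auto
  obtain \<beta>1 K1 u P1 Q1 where one:
    "arc \<beta>1" "pathstart \<beta>1 = b" "pathfinish \<beta>1 = d" "path_image \<beta>1 \<subseteq> insert b (insert d (Y 1))"
    "compact K1" "connected K1" "K1 \<subseteq> insert a (Y 1)" "a \<in> K1" "K1 \<inter> path_image \<beta>1 = {u}" "connected (K1 - {u})"
    "compact P1" "compact Q1" "P1 \<union> Q1 = path_image \<beta>1" "P1 \<inter> Q1 = {u}" "b \<in> P1" "b \<notin> Q1" "d \<in> Q1" "d \<notin> P1"
    by (rule tripod_in_path_connected[of a "Y 1" b d]) (use conn[of 1] pc[of 1] ne[of 1] avs[of 1] dist in auto)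
  obtain \<beta>2 K2 v P2 Q2 where two:
    "arc \<beta>2" "pathstart \<beta>2 = b" "pathfinish \<beta>2 = d" "path_image \<beta>2 \<subseteq> insert b (insert d (Y 2))"
    "compact K2" "connected K2" "K2 \<subseteq> insert a (Y 2)" "a \<in> K2" "K2 \<inter> path_image \<beta>2 = {v}" "connected (K2 - {v})"
    "compact P2" "compact Q2" "P2 \<union> Q2 = path_image \<beta>2" "P2 \<inter> Q2 = {v}" "b \<in> P2" "b \<notin> Q2" "d \<in> Q2" "d \<notin> P2"
    by (rule tripod_in_path_connected[of a "Y 2" b d]) (use conn[of 2] pc[of 2] ne[of 2] avs[of 2] dist in auto)
  define J where "J = path_image \<beta>1 \<union> path_image \<beta>2"
  define K where "K = K1 \<union> K2"
  define P where "P = P1 \<union> P2"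
  define Q where "Q = Q1 \<union> Q2"
  let ?c = "\<beta>1 +++ reversepath \<beta>2"
  have int12: "path_image \<beta>1 \<inter> path_image \<beta>2 \<subseteq> {b, d}"
    using one(4) two(4) d12 by blast
  have "simple_path ?c" using one two int12 by (intro simple_path_join_loop) (auto simp: arc_reversepath)
  moreover have "pathfinish ?c = pathstart ?c" using one two by simp
  moreover have Jc: "path_image ?c = J" using one two by (simp add: J_def path_image_join)
  ultimately have jordan: "inside J \<union> outside J = - J" "connected (inside J)" "connected (outside J)"
     "frontier (inside J) = J" "frontier (outside J) = J" "inside J \<inter> outside J = {}"
     "inside J \<noteq> {}" "outside J \<noteq> {}"
    using Jordan_inside_outside[of ?c] by (simp_all add: inside_Un_outside)
  obtain q where q: "q \<in> Y 3" using ne[of 3] by auto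
  have JY: "J \<subseteq> insert b (insert d (Y 1 \<union> Y 2))" using one two unfolding J_def by auto
  have JPQ: "J = P \<union> Q" using one two unfolding J_def P_def Q_def by auto
  have KY: "K \<subseteq> insert a (Y 1 \<union> Y 2)" using one two unfolding K_def by auto
  have PQ: "b \<in> P" "b \<notin> Q" "d \<in> Q" "d \<notin> P" using one two unfolding P_def Q_def by auto
  \<comment> \<open>The mixed intersections could contain only b or d, and the splitting puts each
    of these in P alone or Q alone. What remains is the two centres u and v, both in K.\<close>
  have PQK: "P \<inter> Q \<subseteq> K"
  proof -
    have "P1 \<inter> Q2 \<subseteq> {b,d}" "P2 \<inter> Q1 \<subseteq> {b,d}" using int12 unfolding one(13)[symmetric] two(13)[symmetric] by auto
    then have "P1 \<inter> Q2 = {}" "P2 \<inter> Q1 = {}" using one(16,18) two(16,18) by auto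
    moreover have "u \<in> K1" "v \<in> K2" using one(9) two(9) by auto
    ultimately show ?thesis unfolding P_def Q_def K_def using one(14) two(14) by auto
  qed
  have cK: "connected K" unfolding K_def using one two by (intro connected_Un) auto
  have cpt: "compact K" "compact P" "compact Q" unfolding K_def P_def Q_def using one two by auto
  have Y3: "connected (insert x (Y 3))" if "x \<in> {a,b,d}" for x
    using conn[of 3 x] that path_connected_imp_connected by auto
  have Y3dj: "Y 3 \<inter> J = {}" "Y 3 \<inter> K = {}" 
    using JY KY d12 avs[of 3] by auto
  have aJ: "a \<notin> J" using JY avs[of 1] avs[of 2] dist by auto
  have bdK: "b \<notin> K" "d \<notin> K" using KY avs[of 1] avs[of 2] dist by auto
  have qJ: "q \<notin> J" using q Y3dj by auto
  \<comment> \<open>Whether q is inside or outside J is unknown; the argument is symmetric, so W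
    names the side of q and W' the other one.\<close>
  obtain W W' where W: "q \<in> W" "connected W" "connected W'" "W' \<noteq> {}" "W \<inter> W' = {}" "W \<union> W' = - J" "frontier W' = J"
  proof (cases "q \<in> inside J")
    case True
    then show ?thesis using jordan that[of "inside J" "outside J"] by blast
  next
    case False
    then have "q \<in> outside J" using jordan(1) qJ by blast
    then show ?thesis using jordan that[of "outside J" "inside J"] by blast
  qed
  obtain q' where q': "q' \<in> W'" using W by auto
  have cJ: "closed J" using cpt JPQ compact_imp_closed by blast
  \<comment> \<open>A connected set off J through q and a point of W' would cross the frontier of
    W', which is J.\<close>
  have oc: "connected_component (- J) q x \<Longrightarrow> x \<in> W" for x
  proof -
    assume c: "connected_component (- J) q x"
    show "x \<in> W"
    proof (rule ccontr)
      assume "x \<notin> W"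
      then have "x \<in> W'" using c W(6) connected_component_in by blast
      then have "connected_component (- J) x q'"
        using W q' unfolding connected_component_def by (metis Un_upper2)
      then have "connected_component (- J) q q'" using c connected_component_trans by blast
      then obtain T where T: "connected T" "T \<subseteq> - J" "q \<in> T" "q' \<in> T" unfolding connected_component_def by blast
      have "T \<inter> frontier W' \<noteq> {}" 
        using T q' W by (intro connected_Int_frontier) auto
      then show False using T W by auto
    qed
  qed
  have cross: "K1 \<inter> path_image \<beta>2 = {}" "K2 \<inter> path_image \<beta>1 = {}"
  proof -
    have "insert a (Y 1) \<inter> insert b (insert d (Y 2)) = {}" "insert a (Y 2) \<inter> insert b (insert d (Y 1)) = {}"
      using d12(1) avs[of 1] avs[of 2] dist by auto
    then show "K1 \<inter> path_image \<beta>2 = {}" "K2 \<inter> path_image \<beta>1 = {}"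
      using one(4,7) two(4,7) by blast+
  qed
  have KJ: "K \<inter> J = {u, v}"
    unfolding K_def J_def Int_Un_distrib Int_Un_distrib2 cross one(9) two(9) by auto
  \<comment> \<open>Each leg without its centre is connected, misses J and contains a, and a is
    joined to q inside \<open>insert a (Y 3)\<close>. Hence K stays clear of W'.\<close>
  have KW: "K - {u,v} \<subseteq> W"
  proof -
    have c: "connected (K1 - {u})" "connected (K2 - {v})" "a \<in> K1 - {u}" "a \<in> K2 - {v}" using one two aJ KJ by auto
    have K12: "K1 - {u} = K1 - {u,v}" "K2 - {v} = K2 - {u,v}"
      using one(9) two(9) cross by auto
    have "(K1 - {u}) \<subseteq> - J" "(K2 - {v}) \<subseteq> - J" using KJ K12 unfolding K_def by auto
    then have cc: "connected_component (- J) a x" if "x \<in> (K1 - {u}) \<union> (K2 - {v})" for x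
      using c that unfolding connected_component_def by blast
    have "connected_component (- J) q a"
      using Y3[of a] Y3dj aJ q by (auto simp: connected_component_def intro!: exI[of _ "insert a (Y 3)"])
    then have "x \<in> W" if "x \<in> (K1 - {u}) \<union> (K2 - {v})" for x
      using oc cc[OF that] connected_component_trans by metis
    then show ?thesis unfolding K_def by auto
  qed
  have W'J: "W' \<inter> J = {}" using W(6) by blast
  have "W' \<inter> (K - {u, v}) = {}" using KW W(5) by blast
  moreover have "W' \<inter> {u, v} = {}" using W'J unfolding KJ[symmetric] by blast
  ultimately have W'K: "W' \<inter> K = {}" by blast
  \<comment> \<open>Leave q through Y 3, pass the curve at the one point x outside R, and continue in W'.\<close>
  have step: "connected_component (- (K \<union> R)) q q'" if R: "x \<in> {b,d}" "x \<notin> R" "x \<in> J" "R \<subseteq> J" for x R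
  proof -
    have "connected (insert x (Y 3))" using Y3 R by auto
    moreover have "insert x (Y 3) \<subseteq> - (K \<union> R)" using R bdK Y3dj by auto
    ultimately have 1: "connected_component (- (K \<union> R)) q x" using q unfolding connected_component_def by blast
    have "x \<in> closure W'" using R(3) unfolding W(7)[symmetric] frontier_def by blast
    then have "connected (insert x W')" 
      using connected_intermediate_closure[OF W(3), of "insert x W'"] closure_subset[of W'] by blast
    moreover have "insert x W' \<subseteq> - (K \<union> R)" using R bdK W'K W'J by auto
    ultimately have "connected_component (- (K \<union> R)) x q'" using q' unfolding connected_component_def by blast
    then show ?thesis using 1 connected_component_trans by blast
  qed
  have "connected_component (- ((K \<union> P) \<union> (K \<union> Q))) q q'"
  proof (rule Janiszewski)
    have "(K \<union> P) \<inter> (K \<union> Q) = K" using PQK by auto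
    then show "connected ((K \<union> P) \<inter> (K \<union> Q))" using cK by simp
    show "compact (K \<union> P)" "closed (K \<union> Q)" using cpt compact_imp_closed by blast+
    show "connected_component (- (K \<union> P)) q q'" by (rule step[of d]) (use PQ JPQ in auto)
    show "connected_component (- (K \<union> Q)) q q'" by (rule step[of b]) (use PQ JPQ in auto)
  qed
  then have "connected_component (- J) q q'"
    by (rule connected_component_of_subset) (use JPQ in auto)
  then show False using oc W q' by blast
qed

subsection \<open>Minors of planar graphs\<close>

text \<open>What is left is the image of a half-open interval, by injectivity. It allows a terminal
  point to be deleted from the arc of an edge that ends there.\<close>

lemma path_connected_arc_minus_end:
  fixes g :: "real \<Rightarrow> 'a::real_normed_vector"
  assumes "arc g" "x \<in> {pathstart g, pathfinish g}"
  shows "path_connected (path_image g - {x})"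
proof -
  have start: "path_connected (path_image h - {pathstart h})" if "arc h" for h :: "real \<Rightarrow> 'a"
  proof -
    have inj: "inj_on h {0..1}" and cont: "continuous_on {0..1} h"
      using that by (auto simp: arc_def path_def)
    have "path_image h - {pathstart h} = h ` ({0..1} - {0})"
      using inj_on_image_set_diff[OF inj, of "{0..1}" "{0}"] by (simp add: path_image_def pathstart_def)
    moreover have "{0..1} - {0} = {0<..(1::real)}" by auto
    moreover have "path_connected (h ` {0<..1})"
      by (intro path_connected_continuous_image continuous_on_subset[OF cont])
         (auto simp: convex_imp_path_connected)
    ultimately show ?thesis by simp
  qed
  show ?thesis
    using assms(2) start[OF assms(1)] start[of "reversepath g"] assms(1)
    by (auto simp: arc_reversepath)
qed

text \<open>The terminals t 1, t 2, t 3 are one side of the bipartition; the connected vertex sets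
  W 1, W 2, W 3 contract to the other side.\<close>

lemma planar_graph_no_K33_minor:
  fixes t :: "nat \<Rightarrow> 'v" and W :: "nat \<Rightarrow> 'v set"
  assumes planar: "planar_graph V E" and EV: "E \<subseteq> V \<times> V"
    and adj_def: "\<And>x y. adj x y \<longleftrightarrow> (x, y) \<in> E \<or> (y, x) \<in> E"
    and tV: "t ` {1,2,3} \<subseteq> V" and inj: "inj_on t {1,2,3}"
    and WV: "\<And>i. i \<in> {1,2,3} \<Longrightarrow> W i \<subseteq> V - t ` {1,2,3}"
    and disj: "\<And>i j. i \<in> {1,2,3} \<Longrightarrow> j \<in> {1,2,3} \<Longrightarrow> i \<noteq> j \<Longrightarrow> W i \<inter> W j = {}"
    and conn: "\<And>i u v. i \<in> {1,2,3} \<Longrightarrow> u \<in> W i \<Longrightarrow> v \<in> W i \<Longrightarrow>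
                 (\<lambda>x y. x \<in> W i \<and> y \<in> W i \<and> adj x y)\<^sup>*\<^sup>* u v"
    and att: "\<And>i j. i \<in> {1,2,3} \<Longrightarrow> j \<in> {1,2,3} \<Longrightarrow> \<exists>w \<in> W i. adj (t j) w"
  shows False
proof -
  obtain f :: "'v \<Rightarrow> complex" and c where inj_f: "inj_on f V"
    and arcs: "\<And>u v. (u, v) \<in> E \<Longrightarrow> arc (c (u, v)) \<and> pathstart (c (u, v)) = f u \<and>
        pathfinish (c (u, v)) = f v \<and> path_image (c (u, v)) \<inter> f ` V \<subseteq> {f u, f v}"
    and cross: "\<And>e1 e2. e1 \<in> E \<Longrightarrow> e2 \<in> E \<Longrightarrow> e1 \<noteq> e2 \<Longrightarrow>
        path_image (c e1) \<inter> path_image (c e2) \<subseteq> f ` ({fst e1, snd e1} \<inter> {fst e2, snd e2})"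
  proof -
    from planar obtain f :: "'v \<Rightarrow> complex" and c where *: "inj_on f V"
      "\<forall>(u, v) \<in> E. arc (c (u, v)) \<and> pathstart (c (u, v)) = f u \<and> pathfinish (c (u, v)) = f v
          \<and> path_image (c (u, v)) \<inter> f ` V \<subseteq> {f u, f v}"
      "\<forall>e1 \<in> E. \<forall>e2 \<in> E. e1 \<noteq> e2 \<longrightarrow>
          path_image (c e1) \<inter> path_image (c e2) \<subseteq> f ` ({fst e1, snd e1} \<inter> {fst e2, snd e2})"
      unfolding planar_graph_def by (elim exE conjE) (rule that)
    show thesis
    proof (rule that[of f c])
      fix e1 e2 assume "e1 \<in> E" "e2 \<in> E" "e1 \<noteq> e2"
      then show "path_image (c e1) \<inter> path_image (c e2) \<subseteq> f ` ({fst e1, snd e1} \<inter> {fst e2, snd e2})"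
        using *(3) by blast
    next
      fix u v assume "(u, v) \<in> E"
      then show "arc (c (u, v)) \<and> pathstart (c (u, v)) = f u \<and>
        pathfinish (c (u, v)) = f v \<and> path_image (c (u, v)) \<inter> f ` V \<subseteq> {f u, f v}"
        using *(2) by fast
    qed (rule *(1))
  qed
  let ?T = "t ` {1,2,3}"
  \<comment> \<open>An edge of E has a fixed orientation, so its ends are compared as an unordered
    pair. \<open>F i\<close> includes the edges leading to terminals; removing the terminal points
    in \<open>Y i\<close> is what makes the three sets disjoint.\<close>
  define F where "F i = {e \<in> E. \<exists>u v. {fst e, snd e} = {u, v} \<and> u \<in> W i \<and> v \<in> W i \<union> ?T}" for i
  define Y where "Y i = (\<Union>e \<in> F i. path_image (c e)) - f ` ?T" for i
  have edge: "\<exists>e \<in> E. {fst e, snd e} = {u, v} \<and> f u \<in> path_image (c e) \<and> f v \<in> path_image (c e)" if uv: "adj u v" for u v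
  proof -
    have "\<exists>e \<in> E. {fst e, snd e} = {u, v}" using uv unfolding adj_def by force
    then obtain e where e: "e \<in> E" "{fst e, snd e} = {u, v}" by blast
    have "{f (fst e), f (snd e)} \<subseteq> path_image (c e)"
      using arcs[of "fst e" "snd e"] e(1) pathstart_in_path_image[of "c e"] pathfinish_in_path_image[of "c e"] by simp
    then have "f ` {fst e, snd e} \<subseteq> path_image (c e)" by simp
    then show ?thesis using e by (intro bexI[of _ e]) simp_all
  qed
  have e_props: "path_connected (path_image (c e))" "path_connected (path_image (c e) - {f v})"
     "path_image (c e) \<inter> f ` V \<subseteq> {f u, f v}"  "u \<in> V" "v \<in> V" "f u \<noteq> f v" "f u \<in> path_image (c e)" "f v \<in> path_image (c e)"
    if e: "e \<in> E" "{fst e, snd e} = {u, v}" for e u v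
  proof -
    have "(fst e, snd e) \<in> E" using e by simp
    note a = arcs[OF this, unfolded prod.collapse]
    show "path_connected (path_image (c e))" using a arc_imp_path path_connected_path_image by blast
    have "f ` {u, v} = {f (fst e), f (snd e)}" using e(2)[symmetric] by simp
    then have fe: "{f u, f v} = {f (fst e), f (snd e)}" by simp
    show "path_connected (path_image (c e) - {f v})"
      by (rule path_connected_arc_minus_end) (use a fe in auto)
    show "path_image (c e) \<inter> f ` V \<subseteq> {f u, f v}" using a fe by simp
    have "{fst e, snd e} \<subseteq> V" using EV e(1) by auto
    then have "{u, v} \<subseteq> V" using e(2) by simp
    then show "u \<in> V" "v \<in> V" by auto
    show "f u \<noteq> f v" using a fe arc_distinct_ends[of "c e"] by (metis doubleton_eq_iff)
    have "{f u, f v} \<subseteq> path_image (c e)" unfolding fe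
      using a pathstart_in_path_image[of "c e"] pathfinish_in_path_image[of "c e"] by simp
    then show "f u \<in> path_image (c e)" "f v \<in> path_image (c e)" by auto
  qed
  have avoidT: "f x \<notin> f ` ?T" if "i \<in> {1,2,3}" "x \<in> W i" for i x
    using WV[OF that(1)] that(2) tV inj_on_image_mem_iff[OF inj_f] by blast
  \<comment> \<open>The arc meets vertex points only in its two ends, and the end u is no terminal.
    Thus at most the endpoint \<open>f v\<close> is lost, and the rest remains
    path-connected.\<close>
  have piece: "\<exists>P. path_connected P \<and> P \<subseteq> Y i \<and> path_image (c e) - f ` ?T \<subseteq> P \<and> f u \<in> P"
    "path_image (c e) - f ` {v} \<subseteq> Y i" "v \<in> W i \<Longrightarrow> path_image (c e) \<subseteq> Y i"
    if i: "i \<in> {1,2,3}" and e: "e \<in> E" "{fst e, snd e} = {u, v}" "u \<in> W i" "v \<in> W i \<union> ?T" for i e u v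
  proof -
    note p = e_props[OF e(1,2)]
    have eF: "e \<in> F i" using e unfolding F_def by blast
    have "f ` ?T \<subseteq> f ` V" using tV by blast
    then have hit: "path_image (c e) \<inter> f ` ?T \<subseteq> {f v}" using p(3) avoidT[OF i e(3)] by auto
    then show sub: "path_image (c e) - f ` {v} \<subseteq> Y i" using eF unfolding Y_def by auto
    show sub2: "path_image (c e) \<subseteq> Y i" if "v \<in> W i"
    proof -
      have "path_image (c e) \<inter> f ` ?T = {}" using hit avoidT[OF i that] by auto
      then show ?thesis using eF unfolding Y_def by blast
    qed
    show "\<exists>P. path_connected P \<and> P \<subseteq> Y i \<and> path_image (c e) - f ` ?T \<subseteq> P \<and> f u \<in> P"
    proof (cases "v \<in> W i")
      case True
      then show ?thesis using sub2 p by (intro exI[of _ "path_image (c e)"]) auto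
    next
      case False
      then have "f v \<in> f ` ?T" using e(4) by blast
      then show ?thesis using sub p by (intro exI[of _ "path_image (c e) - {f v}"]) auto
    qed
  qed
  have WY: "path_component (Y i) (f u) (f v)" if i: "i \<in> {1,2,3}" and uv: "adj u v" "u \<in> W i" "v \<in> W i" for i u v
  proof -
    obtain e where e: "e \<in> E" "{fst e, snd e} = {u, v}" using edge[OF uv(1)] by blast
    note p = e_props[OF e] 
    have "path_image (c e) \<subseteq> Y i" using piece(3)[OF i e uv(2) _ uv(3)] uv(3) by blast
    then show ?thesis using p(1,7,8) by (meson path_component_of_subset path_connected_component)
  qed
  have inW: "f w \<in> Y i" if i: "i \<in> {1,2,3}" "w \<in> W i" for i w
  proof -
    \<comment> \<open>If \<open>W i\<close> is a single vertex it need not have an edge inside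
      \<open>W i\<close>; the edge to a terminal then puts its point into
      \<open>Y i\<close>.\<close>
    obtain w0 where w0: "w0 \<in> W i" "adj (t 1) w0" using att[of i 1] i by blast
    obtain e where e: "e \<in> E" "{fst e, snd e} = {t 1, w0}" using edge[OF w0(2)] by blast
    have e': "{fst e, snd e} = {w0, t 1}" using e by blast
    have "\<exists>P. path_connected P \<and> P \<subseteq> Y i \<and> path_image (c e) - f ` ?T \<subseteq> P \<and> f w0 \<in> P"
      using piece(1)[OF i(1) e(1) e' w0(1)] by simp
    then have b: "f w0 \<in> Y i" by blast
    have "(\<lambda>x y. x \<in> W i \<and> y \<in> W i \<and> adj x y)\<^sup>*\<^sup>* w0 w" using conn[OF i(1) w0(1) i(2)] .
    then show ?thesis
    proof (induction rule: rtranclp_induct)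
      case (step y z)
      then show ?case using WY[OF i(1), of y z] path_component_mem(2) by metis
    qed (rule b)
  qed
  have WWY: "path_component (Y i) (f u) (f v)" if i: "i \<in> {1,2,3}" and "u \<in> W i" "v \<in> W i" for i u v
  proof -
    have "(\<lambda>x y. x \<in> W i \<and> y \<in> W i \<and> adj x y)\<^sup>*\<^sup>* u v" using conn that by blast
    then show ?thesis
    proof (induction rule: rtranclp_induct)
      case base
      then show ?case using inW[OF i that(2)] by (simp add: path_component_refl)
    next
      case (step y z)
      then show ?case using WY[OF i, of y z] path_component_trans by blast
    qed
  qed
  have toW: "\<exists>w \<in> W i. path_component (Y i) z (f w)" if i: "i \<in> {1,2,3}" and z: "z \<in> Y i" for i z
  proof -
    obtain e u v where e: "e \<in> E" "{fst e, snd e} = {u, v}" "u \<in> W i" "v \<in> W i \<union> ?T"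
       "z \<in> path_image (c e) - f ` ?T"
      using z unfolding Y_def F_def by blast
    obtain P where "path_connected P" "P \<subseteq> Y i" "path_image (c e) - f ` ?T \<subseteq> P" "f u \<in> P"
      using piece(1)[OF i e(1-4)] by blast
    then have "path_component (Y i) z (f u)" using e(5)
      by (meson path_component_of_subset path_connected_component subsetD)
    then show ?thesis using e(3) by blast
  qed
  have pcY: "path_connected (Y i)" if i: "i \<in> {1,2,3}" for i
    unfolding path_connected_component
  proof (intro ballI)
    fix y z assume "y \<in> Y i" "z \<in> Y i"
    then obtain v w where "v \<in> W i" "w \<in> W i" "path_component (Y i) y (f v)" "path_component (Y i) z (f w)"
      using toW[OF i] by meson
    then show "path_component (Y i) y z" using WWY[OF i, of v w] path_component_sym path_component_trans by metis
  qed
  show False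
  proof (rule no_plane_K33[of "f (t 1)" "f (t 2)" "f (t 3)" Y])
    fix i :: nat and x assume i: "i \<in> {1,2,3}" and x: "x \<in> {f (t 1), f (t 2), f (t 3)}"
    then obtain j where j: "j \<in> {1,2,3}" "x = f (t j)" by auto
    obtain w where w: "w \<in> W i" "adj (t j) w" using att[OF i j(1)] by blast
    obtain e where e: "e \<in> E" "{fst e, snd e} = {t j, w}" using edge[OF w(2)] by blast
    have e': "{fst e, snd e} = {w, t j}" using e by blast
    note p = e_props[OF e(1) e']
    \<comment> \<open>The arc minus x already lies in \<open>Y i\<close>, so adding the point x
      amounts to adding the whole arc, which meets \<open>Y i\<close> in \<open>f w\<close>.\<close>
    have "path_image (c e) - f ` {t j} \<subseteq> Y i"
      using piece(2)[OF i e(1) e' w(1)] j by blast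
    then have "insert x (Y i) = Y i \<union> path_image (c e)" using p j by auto
    moreover have "path_connected (Y i \<union> path_image (c e))"
      by (rule path_connected_Un) (use pcY[OF i] p inW[OF i w(1)] in auto)
    ultimately show "path_connected (insert x (Y i))" by simp
  next
    fix i :: nat assume i: "i \<in> {1,2,3}"
    show "path_connected (Y i)" using pcY[OF i] .
    obtain w where "w \<in> W i" using att[OF i, of 1] by blast
    then show "Y i \<noteq> {}" using inW[OF i] by blast
    show "Y i \<inter> {f (t 1), f (t 2), f (t 3)} = {}" unfolding Y_def by blast
  next
    fix i j :: nat assume ij: "i \<in> {1,2,3}" "j \<in> {1,2,3}" "i \<noteq> j"
    show "Y i \<inter> Y j = {}"
    proof (rule ccontr)
      assume "Y i \<inter> Y j \<noteq> {}"
      then obtain z d e where z: "z \<in> path_image (c d)" "z \<in> path_image (c e)" "d \<in> F i" "e \<in> F j" "z \<notin> f ` ?T"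
        unfolding Y_def by blast
      obtain u v where d: "d \<in> E" "{fst d, snd d} = {u, v}" "u \<in> W i" "v \<in> W i \<union> ?T"
        using z(3) unfolding F_def by blast
      obtain u' v' where e: "e \<in> E" "{fst e, snd e} = {u', v'}" "u' \<in> W j" "v' \<in> W j \<union> ?T"
        using z(4) unfolding F_def by blast
      \<comment> \<open>Arcs of distinct edges meet only in common ends. Between different branch
        sets a common end must be a terminal, whose point has been removed.\<close>
      have common: "{u, v} \<inter> {u', v'} \<subseteq> ?T"
        using d(3,4) e(3,4) disj[OF ij] by blast
      have "d \<noteq> e"
      proof
        assume "d = e"
        then have "u \<in> {u', v'}" using d(2) e(2) by blast
        then have "u \<in> ?T" using common by blast
        then show False using d(3) WV[OF ij(1)] by blast
      qed
      then have "z \<in> f ` ({u, v} \<inter> {u', v'})"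
        using cross[OF d(1) e(1)] z(1,2) d(2) e(2) by auto
      then show False using common z(5) by blast
    qed
  next
    have "t 1 \<noteq> t 2" "t 1 \<noteq> t 3" "t 2 \<noteq> t 3" using inj_on_eq_iff[OF inj] by auto
    then show "f (t 1) \<noteq> f (t 2)" "f (t 1) \<noteq> f (t 3)" "f (t 2) \<noteq> f (t 3)"
      using inj_on_eq_iff[OF inj_f] tV by auto
  qed
qed

subsection \<open>Covers in the subgroup lattice\<close>

context group
begin

text \<open>Finiteness of Y leaves finitely many candidates, so a largest proper one exists.
  Infinite groups can fail here: a Pruefer group has no maximal subgroup.\<close>

lemma exists_lower_cover:
  assumes "subgroup A G" "subgroup Y G" "finite Y" "A \<subset> Y"
  obtains Z where "maximal_subgroup G Z Y" "A \<subseteq> Z"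
proof -
  let ?S = "{Z. subgroup Z G \<and> A \<subseteq> Z \<and> Z \<subset> Y}"
  have "finite ?S" using assms(3) by (auto intro: finite_subset[of _ "Pow Y"])
  moreover have "A \<in> ?S" using assms by auto
  ultimately obtain Z where "Z \<in> ?S" "\<forall>L \<in> ?S. Z \<subseteq> L \<longrightarrow> Z = L"
    using finite_has_maximal[of ?S] by (metis (no_types, lifting) empty_iff)
  then show ?thesis using that[of Z] assms(2) unfolding maximal_subgroup_def by blast
qed

lemma exists_upper_cover:
  assumes "subgroup A G" "subgroup Y G" "finite Y" "A \<subset> Y"
  obtains Z where "maximal_subgroup G A Z" "Z \<subseteq> Y"
proof -
  let ?S = "{Z. subgroup Z G \<and> A \<subset> Z \<and> Z \<subseteq> Y}"
  have "finite ?S" using assms(3) by (auto intro: finite_subset[of _ "Pow Y"])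
  moreover have "Y \<in> ?S" using assms by auto
  ultimately obtain Z where "Z \<in> ?S" and min: "\<forall>L \<in> ?S. L \<subseteq> Z \<longrightarrow> Z = L"
    using finite_has_minimal[of ?S] by (metis (no_types, lifting) empty_iff)
  then have Z: "subgroup Z G" "A \<subset> Z" "Z \<subseteq> Y" by auto
  have "L = A \<or> L = Z" if "subgroup L G" "A \<subseteq> L" "L \<subseteq> Z" for L
    using min that Z(3) by blast
  then show ?thesis using that[of Z] assms(1) Z unfolding maximal_subgroup_def by simp
qed

text \<open>Induction peels a maximal subgroup containing A off the top of Y. The bounds inside the
  relation record that the chain never leaves the interval from A to Y.\<close>

lemma maximal_subgroup_chain:
  assumes "finite Y" "subgroup A G" "subgroup Y G" "A \<subseteq> Y"
  shows "(\<lambda>U V. maximal_subgroup G U V \<and> A \<subseteq> U \<and> V \<subseteq> Y)\<^sup>*\<^sup>* A Y"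
  using assms(1,3,4)
proof (induction Y rule: finite_psubset_induct)
  case (psubset Y)
  show ?case
  proof (cases "A = Y")
    case False
    then obtain Z where Z: "maximal_subgroup G Z Y" "A \<subseteq> Z"
      using exists_lower_cover assms(2) psubset by (metis psubsetI)
    then have ZY: "subgroup Z G" "Z \<subset> Y" unfolding maximal_subgroup_def by auto
    have "(\<lambda>U V. maximal_subgroup G U V \<and> A \<subseteq> U \<and> V \<subseteq> Z)\<^sup>*\<^sup>* A Z"
      using psubset.IH[OF ZY(2,1) Z(2)] .
    then have "(\<lambda>U V. maximal_subgroup G U V \<and> A \<subseteq> U \<and> V \<subseteq> Y)\<^sup>*\<^sup>* A Z"
      by (rule rtranclp_mono[THEN predicate2D, rotated]) (use ZY in auto)
    then show ?thesis using Z by (simp add: rtranclp.rtrancl_into_rtrancl)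
  qed simp
qed

text \<open>The chain stays in the interval from A to Y, hence in any W containing it. W is kept
  general because the branch sets are unions of intervals.\<close>

lemma interval_connected:
  assumes adj_def: "\<And>U V. adj U V \<longleftrightarrow> maximal_subgroup G U V \<or> maximal_subgroup G V U"
    and "finite Y" "subgroup A G" "subgroup Y G" "A \<subseteq> Y"
    and W: "\<And>U. subgroup U G \<Longrightarrow> A \<subseteq> U \<Longrightarrow> U \<subseteq> Y \<Longrightarrow> U \<in> W"
  shows "(\<lambda>U V. U \<in> W \<and> V \<in> W \<and> adj U V)\<^sup>*\<^sup>* A Y" "(\<lambda>U V. U \<in> W \<and> V \<in> W \<and> adj U V)\<^sup>*\<^sup>* Y A"
proof -
  let ?R = "\<lambda>U V. U \<in> W \<and> V \<in> W \<and> adj U V"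
  show XY: "?R\<^sup>*\<^sup>* A Y"
    using maximal_subgroup_chain[OF assms(2-5)]
    by (rule rtranclp_mono[THEN predicate2D, rotated])
       (use W in \<open>auto simp: adj_def maximal_subgroup_def\<close>)
  have "symp ?R" by (auto simp: symp_def adj_def)
  then show "?R\<^sup>*\<^sup>* Y A" using XY by (meson symp_rtranclp sympD)
qed

section \<open>A K33 minor in the subgroup graph\<close>

text \<open>The terminals are the Z i. The three branch sets consist of the subgroups of H above some Z i,
  of those below some Z i, and of those in some M i that contain C or lie above Z i.\<close>

lemma planar_group_no_K33:
  fixes Z M :: "nat \<Rightarrow> 'a set"
  assumes planar: "planar_group G"
    and H: "subgroup H G" "finite H" and C: "subgroup C G" "\<not> C \<subseteq> H"
    and Z: "\<And>i. i \<in> {1,2,3} \<Longrightarrow> subgroup (Z i) G" 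
    and M: "\<And>i. i \<in> {1,2,3} \<Longrightarrow> subgroup (M i) G" "\<And>i. i \<in> {1,2,3} \<Longrightarrow> finite (M i)"
      "\<And>i. i \<in> {1,2,3} \<Longrightarrow> C \<subseteq> M i" "\<And>i. i \<in> {1,2,3} \<Longrightarrow> H \<inter> M i = Z i"
    and incomp: "\<And>i j. i \<in> {1,2,3} \<Longrightarrow> j \<in> {1,2,3} \<Longrightarrow> i \<noteq> j \<Longrightarrow> \<not> Z i \<subseteq> Z j"
  shows False
proof -
  define adj where "adj U V \<longleftrightarrow> maximal_subgroup G U V \<or> maximal_subgroup G V U" for U V
  let ?I = "{1,2,3::nat}"
  define WH where "WH = {A. subgroup A G \<and> A \<subseteq> H \<and> (\<exists>i\<in>?I. Z i \<subset> A)}"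
  define WL where "WL = {A. subgroup A G \<and> (\<exists>i\<in>?I. A \<subset> Z i)}"
  \<comment> \<open>Both alternatives are needed: the subgroups strictly above \<open>Z i\<close>
    lead from \<open>Z i\<close> up to \<open>M i\<close>, and those containing C link the different
    \<open>M i\<close>. A cover of \<open>Z i\<close> in \<open>M i\<close> need not contain
    C.\<close>
  define WC where "WC = {A. subgroup A G \<and> (\<exists>i\<in>?I. A \<subseteq> M i \<and> (C \<subseteq> A \<or> Z i \<subset> A))}"
  define W where "W i = (if i = 1 then WH else if i = 2 then WL else WC)" for i :: nat
  have ZH: "Z i \<subseteq> H" "Z i \<subseteq> M i" if "i \<in> ?I" for i using M(4)[OF that] by auto
  have other: "\<exists>j\<in>?I. j \<noteq> i" for i :: nat by (cases "i = 1") auto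
  \<comment> \<open>Comparison with a second \<open>Z j\<close> excludes both extremes: H would
    contain \<open>Z j\<close>, and the trivial subgroup, treated in \<open>Zn1\<close>, would lie
    in it.\<close>
  have ZnH: "Z i \<subset> H" if i: "i \<in> ?I" for i
  proof -
    obtain j where j: "j \<in> ?I" "j \<noteq> i" using other by blast
    then have "Z i \<noteq> H" using incomp[OF j(1) i j(2)] ZH(1)[OF j(1)] by blast
    then show ?thesis using ZH(1)[OF i] by blast
  qed
  have finZ: "finite (Z i)" if "i \<in> ?I" for i using ZH(1)[OF that] H(2) by (rule finite_subset)
  have Zn1: "{\<one>} \<subset> Z i" if i: "i \<in> ?I" for i
  proof -
    obtain j where j: "j \<in> ?I" "j \<noteq> i" using other by blast
    have "{\<one>} \<subseteq> Z j" "{\<one>} \<subseteq> Z i"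
      using subgroup.one_closed[OF Z[OF i]] subgroup.one_closed[OF Z[OF j(1)]] by auto
    then show ?thesis using incomp[OF i j(1)] j(2) by blast
  qed
  have ZnC: "\<not> C \<subseteq> Z i" if "i \<in> ?I" for i using ZH(1)[OF that] C(2) by blast
  have ZltM: "Z i \<subset> M i" if i: "i \<in> ?I" for i using ZnC[OF i] ZH(2)[OF i] M(3)[OF i] by blast
  have triv: "subgroup {\<one>} G" by (rule triv_subgroup)
  let ?R = "\<lambda>W U V. U \<in> W \<and> V \<in> W \<and> adj U V"
  \<comment> \<open>Each branch set is connected through a hub: H for \<open>WH\<close>, the trivial
    subgroup for \<open>WL\<close>, and C for \<open>WC\<close>, where the route climbs to some
    \<open>M i\<close> and descends to C.\<close>
  have cH: "(?R WH)\<^sup>*\<^sup>* A H" "(?R WH)\<^sup>*\<^sup>* H A" if A: "A \<in> WH" for A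
  proof -
    have A': "subgroup A G" "A \<subseteq> H" using A unfolding WH_def by auto
    have "U \<in> WH" if "subgroup U G" "A \<subseteq> U" "U \<subseteq> H" for U
      using that A unfolding WH_def by blast
    note int = interval_connected[OF adj_def H(2) A'(1) H(1) A'(2) this]
    show "(?R WH)\<^sup>*\<^sup>* A H" "(?R WH)\<^sup>*\<^sup>* H A" by (rule int; assumption)+
  qed
  have cL: "(?R WL)\<^sup>*\<^sup>* A {\<one>}" "(?R WL)\<^sup>*\<^sup>* {\<one>} A" if A: "A \<in> WL" for A
  proof -
    obtain i where i: "i \<in> ?I" "A \<subset> Z i" and A': "subgroup A G" using A unfolding WL_def by blast
    have fA: "finite A" "{\<one>} \<subseteq> A"
      using finZ[OF i(1)] i(2) subgroup.one_closed[OF A'] by (auto intro: finite_subset)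
    have "U \<in> WL" if "subgroup U G" "{\<one>} \<subseteq> U" "U \<subseteq> A" for U
      using that i unfolding WL_def by blast
    note int = interval_connected[OF adj_def fA(1) triv A' fA(2) this]
    show "(?R WL)\<^sup>*\<^sup>* A {\<one>}" "(?R WL)\<^sup>*\<^sup>* {\<one>} A" by (rule int; assumption)+
  qed
  have cM: "(?R WC)\<^sup>*\<^sup>* C (M i)" "(?R WC)\<^sup>*\<^sup>* (M i) C" if i: "i \<in> ?I" for i
  proof -
    have "U \<in> WC" if "subgroup U G" "C \<subseteq> U" "U \<subseteq> M i" for U
      using that i unfolding WC_def by blast
    note int = interval_connected[OF adj_def M(2)[OF i] C(1) M(1)[OF i] M(3)[OF i] this]
    show "(?R WC)\<^sup>*\<^sup>* C (M i)" "(?R WC)\<^sup>*\<^sup>* (M i) C" by (rule int; assumption)+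
  qed
  have cC: "(?R WC)\<^sup>*\<^sup>* A C" "(?R WC)\<^sup>*\<^sup>* C A" if A: "A \<in> WC" for A
  proof -
    obtain i where i: "i \<in> ?I" "A \<subseteq> M i" "C \<subseteq> A \<or> Z i \<subset> A" and x: "subgroup A G"
      using A unfolding WC_def by blast
    have "U \<in> WC" if "subgroup U G" "A \<subseteq> U" "U \<subseteq> M i" for U
      using that i unfolding WC_def by blast
    note int = interval_connected[OF adj_def M(2)[OF i(1)] x M(1)[OF i(1)] i(2) this]
    show "(?R WC)\<^sup>*\<^sup>* A C"
      by (rule rtranclp_trans[OF _ cM(2)[OF i(1)]]) (rule int; assumption)
    show "(?R WC)\<^sup>*\<^sup>* C A"
      by (rule rtranclp_trans[OF cM(1)[OF i(1)]]) (rule int; assumption)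
  qed
  have notT: "A \<notin> Z ` ?I" if A: "A \<in> WH \<union> WL \<union> WC" for A
  proof
    assume "A \<in> Z ` ?I"
    then obtain j where j: "j \<in> ?I" "A = Z j" by blast
    from A consider i where "i \<in> ?I" "Z i \<subset> A" | i where "i \<in> ?I" "A \<subset> Z i" | "C \<subseteq> A"
      unfolding WH_def WL_def WC_def by blast
    then show False
    proof cases
      case (1 i) then show ?thesis using incomp[of i j] j by blast
    next
      case (2 i) then show ?thesis using incomp[of j i] j by blast
    next
      case 3 then show ?thesis using ZnC j by blast
    qed
  qed
  have chain: "\<not> (Z i \<subset> A \<and> A \<subset> Z j)" if "i \<in> ?I" "j \<in> ?I" for i j A
    using incomp[OF that] by (cases "i = j") blast+
  have "WH \<inter> WL = {}" unfolding WH_def WL_def using chain by blast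
  moreover have "WH \<inter> WC = {}"
  proof -
    \<comment> \<open>A subgroup of both H and \<open>M i\<close> lies in \<open>Z i\<close>, so it
      is not strictly above \<open>Z i\<close>; nor does it contain C, which is not inside
      H.\<close>
    have False if i: "i \<in> ?I" "A \<subseteq> H" "A \<subseteq> M i" "C \<subseteq> A \<or> Z i \<subset> A" for i A
      using M(4)[OF i(1)] i C(2) by blast
    then show ?thesis unfolding WH_def WC_def by blast
  qed
  moreover have "WL \<inter> WC = {}"
  proof -
    have False if i: "i \<in> ?I" "j \<in> ?I" "A \<subset> Z j" "C \<subseteq> A \<or> Z i \<subset> A" for i j A
      using chain[OF i(1,2)] ZnC[OF i(2)] i by blast
    then show ?thesis unfolding WL_def WC_def by blast
  qed
  ultimately have disj: "W i \<inter> W j = {}" if "i \<in> ?I" "j \<in> ?I" "i \<noteq> j" for i j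
    using that unfolding W_def by auto
  have conn: "(?R (W i))\<^sup>*\<^sup>* u v" if "u \<in> W i" "v \<in> W i" for i u v
  proof -
    consider "W i = WH" | "W i = WL" | "W i = WC" unfolding W_def by presburger
    then show ?thesis
    proof cases
      case 1 show ?thesis using that rtranclp_trans[OF cH(1)[of u] cH(2)[of v]] unfolding 1 by blast
    next
      case 2 show ?thesis using that rtranclp_trans[OF cL(1)[of u] cL(2)[of v]] unfolding 2 by blast
    next
      case 3 show ?thesis using that rtranclp_trans[OF cC(1)[of u] cC(2)[of v]] unfolding 3 by blast
    qed
  qed
  have att: "\<exists>w \<in> W i. adj (Z j) w" if j: "j \<in> ?I" for i j
  proof -
    obtain A1 where "maximal_subgroup G (Z j) A1" "A1 \<subseteq> H"
      using exists_upper_cover[OF Z[OF j] H(1,2) ZnH[OF j]] .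
    then have "A1 \<in> WH \<and> adj (Z j) A1" using j unfolding WH_def adj_def maximal_subgroup_def by blast
    moreover obtain A2 where "maximal_subgroup G A2 (Z j)"
      using exists_lower_cover[OF triv Z[OF j] finZ[OF j] Zn1[OF j]] .
    then have "A2 \<in> WL \<and> adj (Z j) A2" using j unfolding WL_def adj_def maximal_subgroup_def by blast
    moreover obtain A3 where "maximal_subgroup G (Z j) A3" "A3 \<subseteq> M j"
      using exists_upper_cover[OF Z[OF j] M(1,2)[OF j] ZltM[OF j]] .
    then have "A3 \<in> WC \<and> adj (Z j) A3" using j unfolding WC_def adj_def maximal_subgroup_def by blast
    ultimately show ?thesis unfolding W_def by auto
  qed
  show False
  proof (rule planar_graph_no_K33_minor)
    show "planar_graph (subgroup_graph_vertices G) (subgroup_graph_edges G)"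
      using planar by (simp add: planar_group_def)
    show "subgroup_graph_edges G \<subseteq> subgroup_graph_vertices G \<times> subgroup_graph_vertices G"
      by (auto simp: subgroup_graph_edges_def subgroup_graph_vertices_def maximal_subgroup_def)
    show "adj x y \<longleftrightarrow> (x, y) \<in> subgroup_graph_edges G \<or> (y, x) \<in> subgroup_graph_edges G" for x y
      by (simp add: adj_def subgroup_graph_edges_def)
    show "Z ` ?I \<subseteq> subgroup_graph_vertices G"
      using Z unfolding subgroup_graph_vertices_def by blast
    show "inj_on Z ?I" using incomp by (metis inj_onI order_refl)
    show "W i \<subseteq> subgroup_graph_vertices G - Z ` ?I" for i
    proof
      fix A assume "A \<in> W i"
      then have A: "A \<in> WH \<union> WL \<union> WC" unfolding W_def by (simp split: if_splits)
      then have "subgroup A G" unfolding WH_def WL_def WC_def by blast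
      then show "A \<in> subgroup_graph_vertices G - Z ` ?I"
        using notT[OF A] unfolding subgroup_graph_vertices_def by simp
    qed
    show "W i \<inter> W j = {}" if "i \<in> ?I" "j \<in> ?I" "i \<noteq> j" for i j
      using disj that .
    show "(?R (W i))\<^sup>*\<^sup>* u v" if "u \<in> W i" "v \<in> W i" for i u v
      using conn that .
    show "\<exists>w \<in> W i. adj (Z j) w" if "j \<in> ?I" for i j
      using att that .
  qed
qed

section \<open>Raising the number of generators by one\<close>

lemma n_locally_finite_Suc:
  assumes planar: "planar_group G" and fin: "n_locally_finite n G" and n: "n \<ge> 2"
  shows "n_locally_finite (Suc n) G"
  unfolding n_locally_finite_def
proof (intro allI impI, rule ccontr)
  fix S assume S: "S \<subseteq> carrier G" "finite S" "card S \<le> Suc n" "infinite (generate G S)"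
  then have "card S = Suc n" using fin unfolding n_locally_finite_def by (metis le_Suc_eq)
  then obtain g T where gT: "S = insert g T" "card T = n" "finite T" 
    by (metis S(2) card_Suc_eq finite_insert)
  \<comment> \<open>Here n \<ge> 2 enters: T has two elements to split off, leaving m = n - 2 for R,
    so g, \<open>x i\<close> and R together number at most n.\<close>
  obtain m where m: "n = Suc (Suc m)" using n by (metis Suc_le_D add_2_eq_Suc le_Suc_ex)
  obtain h1 T' where h1: "T = insert h1 T'" "card T' = Suc m"
    using gT m by (metis card_Suc_eq)
  obtain h2 R where h2: "T' = insert h2 R" "card R = m" 
    using h1 by (metis card_Suc_eq)
  have finR: "finite R" using gT h1 h2 by simp
  have c: "g \<in> carrier G" "h1 \<in> carrier G" "h2 \<in> carrier G" "R \<subseteq> carrier G" "T \<subseteq> carrier G"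
    using S gT h1 h2 by auto
  define x where "x i = (if i = 1 then h1 else if i = 2 then h2 else h1 \<otimes> h2)" for i :: nat
  have xc: "x i \<in> carrier G" for i using c by (simp add: x_def)
  have gens: "h1 \<in> L \<and> h2 \<in> L"
    if "i \<in> {1,2,3}" "j \<in> {1,2,3}" "i \<noteq> j" "subgroup L G" "x i \<in> L" "x j \<in> L" for i j L
  proof -
    have "h2 \<in> L" if "h1 \<in> L" "h1 \<otimes> h2 \<in> L"
      using subgroup.m_closed[OF \<open>subgroup L G\<close> subgroup.m_inv_closed[OF \<open>subgroup L G\<close> that(1)] that(2)] c
      by (simp add: m_assoc[symmetric])
    moreover have "h1 \<in> L" if "h2 \<in> L" "h1 \<otimes> h2 \<in> L"
      using subgroup.m_closed[OF \<open>subgroup L G\<close> that(2) subgroup.m_inv_closed[OF \<open>subgroup L G\<close> that(1)]] c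
      by (simp add: m_assoc)
    ultimately show ?thesis using that unfolding x_def by (auto split: if_splits)
  qed
  define H where "H = generate G T"
  define M where "M i = generate G (insert g (insert (x i) R))" for i
  define Z where "Z i = H \<inter> M i" for i
  have H: "subgroup H G" "finite H" "T \<subseteq> H"
    using fin gT c generate_is_subgroup unfolding H_def n_locally_finite_def by (auto intro: generate.incl)
  have M: "subgroup (M i) G" "finite (M i)" "insert g (insert (x i) R) \<subseteq> M i" for i
  proof -
    have s: "insert g (insert (x i) R) \<subseteq> carrier G" using c xc by auto
    then show "subgroup (M i) G" "insert g (insert (x i) R) \<subseteq> M i"
      unfolding M_def by (auto intro: generate_is_subgroup generate.incl)
    have "card (insert g (insert (x i) R)) \<le> n"
      using h2 m finR by (metis card_insert_le_m1 diff_Suc_1 finite_insert order_refl zero_less_Suc)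
    then show "finite (M i)" using fin s finR unfolding M_def n_locally_finite_def by simp
  qed
  \<comment> \<open>Both the condition on C and the incomparability reduce to this: no finite
    subgroup contains all of S.\<close>
  have Ssub: "finite L \<Longrightarrow> subgroup L G \<Longrightarrow> \<not> S \<subseteq> L" for L
    using generate_subgroup_incl[of S L] S(4) finite_subset by blast
  show False
  proof (rule planar_group_no_K33[OF planar H(1,2), of "generate G {g}" Z M])
    show "subgroup (generate G {g}) G" using c generate_is_subgroup by simp
    have "g \<in> generate G {g}" by (simp add: generate.incl)
    then show "\<not> generate G {g} \<subseteq> H" using Ssub[OF H(2,1)] H(3) gT by auto
    show "subgroup (Z i) G" for i unfolding Z_def using subgroups_Inter_pair H M by blast
    show "generate G {g} \<subseteq> M i" for i
      using generate_subgroup_incl[of "{g}" "M i"] M(1,3)[of i] by simp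
    show "\<not> Z i \<subseteq> Z j" if ij: "i \<in> {1,2,3}" "j \<in> {1,2,3}" "i \<noteq> j" for i j
    proof
      assume "Z i \<subseteq> Z j"
      \<comment> \<open>Since \<open>x i\<close> lies in H as well as in \<open>M i\<close>, the
        inclusion forces it into \<open>M j\<close>. Together with \<open>x j\<close> it yields h1
        and h2, hence all of S in the finite group \<open>M j\<close>.\<close>
      moreover have "x i \<in> H"
        using H(1,3) h1 h2 subgroup.m_closed[OF H(1)] by (auto simp: x_def)
      ultimately have "x i \<in> M j" using M(3)[of i] unfolding Z_def by blast
      then have "h1 \<in> M j \<and> h2 \<in> M j" using gens[OF ij M(1)[of j]] M(3)[of j] by blast
      then have "S \<subseteq> M j" using gT h1 h2 M(3)[of j] by blast
      then show False using Ssub M by blast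
    qed
    show "subgroup (M i) G" "finite (M i)" "H \<inter> M i = Z i" for i
      using M(1,2)[of i] unfolding Z_def by simp_all
  qed
qed

end

theorem theorem2p3:
  fixes G :: "('a, 'b) monoid_scheme"
  assumes "group G"
    and "planar_group G"
    and "n_locally_finite 2 G"
  shows "locally_finite_group G"
proof -
  have two_le: "n_locally_finite n G" if "n \<ge> 2" for n
    using that
  proof (induction n rule: dec_induct)
    case (step n)
    then show ?case using group.n_locally_finite_Suc[OF assms(1,2)] by blast
  qed (rule assms(3))
  show ?thesis
    unfolding locally_finite_group_def
  proof (intro allI impI)
    fix n :: nat
    \<comment> \<open>The maximum covers n = 1, where the induction from 2 does not reach: a bound
      on the number of generators may always be lowered.\<close>
    have "n_locally_finite (max 2 n) G" by (rule two_le) simp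
    then show "n_locally_finite n G" unfolding n_locally_finite_def by auto
  qed
qed

end
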